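(* As formal power series in $q$ with coefficients polynomials in $z$: $$\sum_{\lambda\in\mathcal{G}_1}z^{a(\lambda)}q^{|\lambda|}=\sum_{n=0}^{\infty}\frac{z^{2n}q^{2\binom{2n+1}{2}}(-z/q;q^2)_{2n}}{(q^4;q^4)_{n}(z^2q^2;q^4)_{n}}+\sum_{n=0}^{\infty}\frac{z^{2n+2}q^{2\binom{2n+2}{2}}(-zq;q^2)_{2n}\left(1+\frac{1}{zq}\right)}{(q^4;q^4)_{n}(z^2q^2;q^4)_{n+1}},$$ $$\sum_{\lambda\in\mathcal{G}_2}z^{a(\lambda)}q^{|\lambda|}=\sum_{n=0}^{\infty}\frac{z^{2n}q^{2\binom{2n+1}{2}}(-zq;q^2)_{2n}}{(q^4;q^4)_{n}(z^2q^2;q^4)_{n}}+\sum_{n=0}^{\infty}\frac{z^{2n+2}q^{2\binom{2n+2}{2}}(-zq;q^2)_{2n+1}}{(q^4;q^4)_{n}(z^2q^2;q^4)_{n+1}},$$ $$\sum_{\lambda\in\mathcal{G}_1}z^{a(\lambda)}q^{S(\lambda)}=\sum_{n=0}^{\infty}\frac{z^{2n}q^{4\binom{n+1}{2}}(-z;q)_{2n}}{(q^2;q^2)_{n}(z^2q^2;q^2)_{n}}+\sum_{n=0}^{\infty}\frac{z^{2n+2}q^{2(n+1)^2}(-zq;q)_{2n}\left(1+\frac{1}{zq}\right)}{(q^2;q^2)_{n}(z^2q^2;q^2)_{n+1}},$$ $$\sum_{\lambda\in\mathcal{G}_2}z^{a(\lambda)}q^{S(\lambda)}=\sum_{n=0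}^{\infty}\frac{z^{2n}q^{4\binom{n+1}{2}}(-zq;q)_{2n}}{(q^2;q^2)_{n}(z^2q^2;q^2)_{n}}+\sum_{n=0}^{\infty}\frac{z^{2n+2}q^{2(n+1)^2}(-zq;q)_{2n+1}}{(q^2;q^2)_{n}(z^2q^2;q^2)_{n+1}}.$$
   Context: A partition is a finite weakly decreasing sequence of positive integers $\lambda=(\lambda_1,\ldots,\lambda_\ell)$ (the empty partition is included), of length $\ell(\lambda)=\ell$ and weight $|\lambda|=\lambda_1+\cdots+\lambda_\ell$. The alternating sum is $a(\lambda)=\lambda_1-\lambda_2+\lambda_3-\cdots+(-1)^{\ell-1}\lambda_\ell$ and the Schmidt weight is $S(\lambda)=\lambda_1+\lambda_3+\lambda_5+\cdots$ (the sum of the odd-indexed parts). $\mathcal{G}_1$ is the set of partitions such that for all $1\le i<\ell(\lambda)$, $\lambda_i-\lambda_{i+1}\geq 2$, and $\lambda_i-\lambda_{i+1}\geq 3$ if $\lambda_i$ is odd. $\mathcal{G}_2$ is the set of partitions in $\mathcal{G}_1$ all of whose parts are at least $2$. Both contain the empty partition. Notation: $(a;q)_0=1$, $(a;q)_n=\prod_{i=0}^{n-1}(1-aq^i)$. Negative powers of $q$ and $z$ cancel against the monomial prefactors. *)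

theory Defs
  imports
    "HOL-Analysis.Analysis"
    "HOL-Computational_Algebra.Computational_Algebra"
begin

section \<open>Partitions\<close>

text \<open>Lists are indexed from 0, so the part \<open>\<lambda>\<^sub>i\<close> is \<open>l ! (i - 1)\<close>.\<close>

definition is_partition :: "nat list \<Rightarrow> bool" where
  "is_partition l \<longleftrightarrow> sorted_wrt (\<ge>) l \<and> (\<forall>x\<in>set l. 0 < x)"

abbreviation weight :: "nat list \<Rightarrow> nat" where
  "weight l \<equiv> sum_list l"

definition alt_sum :: "nat list \<Rightarrow> int" where
  "alt_sum l = (\<Sum>i<length l. (-1) ^ i * int (l ! i))"

definition schmidt_weight :: "nat list \<Rightarrow> nat" where
  "schmidt_weight l = (\<Sum>i | i < length l \<and> even i. l ! i)"

definition G1 :: "nat list set" where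
  "G1 = {l. is_partition l \<and>
     (\<forall>i. Suc i < length l \<longrightarrow>
        l ! i \<ge> l ! Suc i + 2 \<and> (odd (l ! i) \<longrightarrow> l ! i \<ge> l ! Suc i + 3))}"

definition G2 :: "nat list set" where
  "G2 = {l \<in> G1. \<forall>x\<in>set l. 2 \<le> x}"

lemma alt_sum_Nil [simp]: "alt_sum [] = 0"
  by (simp add: alt_sum_def)

lemma alt_sum_Cons [simp]: "alt_sum (x # l) = int x - alt_sum l"
  by (simp add: alt_sum_def sum.lessThan_Suc_shift sum_negf del: sum.lessThan_Suc)

lemma alt_sum_bounds:
  assumes "sorted_wrt (\<ge>) l"
  shows "0 \<le> alt_sum l \<and> alt_sum l \<le> (if l = [] then 0 else int (hd l))"
  using assms
proof (induction l)
  case (Cons x l)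
  then show ?case by (cases l) auto
qed simp

text \<open>Hence the truncation \<open>nat (alt_sum l)\<close> below loses nothing.\<close>

lemma alt_sum_nonneg: "is_partition l \<Longrightarrow> 0 \<le> alt_sum l"
  using alt_sum_bounds by (auto simp: is_partition_def)


section \<open>Series\<close>

text \<open>
  The generating functions are formal power series in \<open>q\<close> over \<open>\<int>[z]\<close>, of type
  \<^typ>\<open>int poly fps\<close>; sums are taken in the \<open>q\<close>-adic topology which the library puts on
  this type.
\<close>

definition zq_monom :: "nat \<Rightarrow> nat \<Rightarrow> int poly fps" where
  "zq_monom a w = fps_const (monom 1 a) * fps_X ^ w"

text \<open>
  The summands on the \<open>q\<close>-series side contain quotients and negative powers of \<open>q\<close> and
  \<open>z\<close>. They are evaluated in the field of formal Laurent series in \<open>q\<close> over the field of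
  fractions of \<open>\<int>[z]\<close>, in which \<open>\<int>[z][[q]]\<close> is embedded as a subring.
\<close>

type_synonym laurent = "int poly fract fls"

definition Z :: laurent where
  "Z = fls_const (to_fract (monom 1 1))"

definition Q :: laurent where
  "Q = fls_X"

definition emb :: "int poly fps \<Rightarrow> laurent" where
  "emb f = fps_to_fls (Abs_fps (\<lambda>n. to_fract (fps_nth f n)))"

lemma to_fract_sum: "to_fract (sum f A) = (\<Sum>x\<in>A. to_fract (f x))"
  by (induction A rule: infinite_finite_induct) auto

lemma emb_0 [simp]: "emb 0 = 0"
  by (simp add: emb_def fls_eq_iff)

lemma emb_1 [simp]: "emb 1 = 1"
proof -
  have "Abs_fps (\<lambda>n. to_fract (fps_nth (1 :: int poly fps) n)) = 1"
    by (rule fps_ext) simp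
  then show ?thesis by (simp add: emb_def)
qed

lemma emb_add [simp]: "emb (f + g) = emb f + emb g"
proof -
  have "Abs_fps (\<lambda>n. to_fract (fps_nth (f + g) n)) =
        Abs_fps (\<lambda>n. to_fract (fps_nth f n)) + Abs_fps (\<lambda>n. to_fract (fps_nth g n))"
    by (rule fps_ext) simp
  then show ?thesis by (simp add: emb_def fps_to_fls_plus)
qed

lemma emb_mult [simp]: "emb (f * g) = emb f * emb g"
proof -
  have "Abs_fps (\<lambda>n. to_fract (fps_nth (f * g) n)) =
        Abs_fps (\<lambda>n. to_fract (fps_nth f n)) * Abs_fps (\<lambda>n. to_fract (fps_nth g n))"
    by (rule fps_ext) (simp add: fps_mult_nth to_fract_sum)
  then show ?thesis by (simp add: emb_def fls_times_fps_to_fls)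
qed

lemma emb_eq_iff [simp]: "emb f = emb g \<longleftrightarrow> f = g"
  by (auto simp: emb_def fps_eq_iff)

lemma emb_power [simp]: "emb (f ^ n) = emb f ^ n"
  by (induction n) auto

lemma emb_fps_X: "emb fps_X = Q"
proof -
  have "Abs_fps (\<lambda>n. to_fract (fps_nth (fps_X :: int poly fps) n)) = fps_X"
    by (rule fps_ext) simp
  then show ?thesis by (simp add: emb_def Q_def)
qed

lemma emb_z: "emb (fps_const (monom 1 1)) = Z"
proof -
  have "Abs_fps (\<lambda>n. to_fract (fps_nth (fps_const (monom 1 1) :: int poly fps) n)) =
        fps_const (to_fract (monom 1 1))"
    by (rule fps_ext) simp
  then show ?thesis by (simp add: emb_def Z_def)
qed

lemma emb_zq_monom: "emb (zq_monom a w) = Z ^ a * Q ^ w"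
proof -
  have "(fps_const (monom 1 a) :: int poly fps) = fps_const (monom 1 1) ^ a"
    by (simp add: fps_const_power monom_power)
  then show ?thesis by (simp only: zq_monom_def emb_mult emb_power emb_z emb_fps_X)
qed

text \<open>
  \<open>series_sums t s\<close>: all negative powers in the terms \<open>t n\<close> cancel, so that the
  \<open>t n\<close> are elements of \<open>\<int>[z][[q]]\<close>, and there their series converges to \<open>s\<close>.
\<close>

definition series_sums :: "(nat \<Rightarrow> laurent) \<Rightarrow> int poly fps \<Rightarrow> bool" where
  "series_sums t s \<longleftrightarrow> (\<exists>A. (\<forall>n. emb (A n) = t n) \<and> A sums s)"

definition qpoch :: "'a::comm_ring_1 \<Rightarrow> 'a \<Rightarrow> nat \<Rightarrow> 'a" where
  "qpoch a q n = (\<Prod>i<n. 1 - a * q ^ i)"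

end

theory Submission
  imports Defs
begin

text \<open>
  Write \<open>d\<^sub>i = \<lambda>\<^sub>i - \<lambda>\<^sub>i\<^sub>+\<^sub>1\<close> (with \<open>\<lambda>\<^sub>i = 0\<close> beyond the length \<open>m\<close>) and let \<open>e\<^sub>i\<close> be the parity
  of \<open>\<lambda>\<^sub>i\<close>. The gap conditions say exactly that \<open>d\<^sub>i = 2 + e\<^sub>i + e\<^sub>i\<^sub>+\<^sub>1 + 2 k\<^sub>i\<close> with \<open>k\<^sub>i \<ge> 0\<close>, and the
  parities \<open>e\<^sub>i\<close> and the numbers \<open>k\<^sub>i\<close> can be chosen freely; for \<open>G1\<close> the last gap is
  \<open>2 - e\<^sub>m + 2 k\<^sub>m\<close> instead. The alternating sum, the weight and the Schmidt weight are linear in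
  the gaps, so every \<open>d\<^sub>i\<close> enters through a power of a monomial \<open>u\<^sub>i\<close>, and summing over partitions
  of length \<open>m\<close> in \<open>G2\<close> gives, with \<open>u\<^sub>0 = 1\<close>, the product over \<open>i = 1, \<dots>, m\<close> of
  \<open>u\<^sub>i\<^sup>2 (1 + u\<^sub>i\<^sub>-\<^sub>1 u\<^sub>i) / (1 - u\<^sub>i\<^sup>2)\<close>. For \<open>G1\<close> the last factor has \<open>u\<^sub>m\<^sub>-\<^sub>1 / u\<^sub>m\<close> in place of
  \<open>u\<^sub>m\<^sub>-\<^sub>1 u\<^sub>m\<close>. Even and odd \<open>m\<close> yield the two series of each identity.
\<close>

unbundle no vec_syntax

section \<open>Infinite sums of formal power series\<close>

text \<open>Convergence means that every coefficient is eventually constant, and coefficient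
  \<open>n\<close> of a sum depends on coefficients \<open>n\<close> alone. The rules for
  \<open>has_sum\<close> on unions and products of index sets rest on this continuity.\<close>

instance fps :: (ab_group_add) topological_comm_monoid_add
proof
  fix a b :: "'a fps"
  have "((\<lambda>p. fst p) \<longlongrightarrow> a) (nhds a \<times>\<^sub>F nhds b)" "((\<lambda>p. snd p) \<longlongrightarrow> b) (nhds a \<times>\<^sub>F nhds b)"
    by (rule filterlim_fst, rule filterlim_snd)
  then have ev: "\<forall>\<^sub>F p in nhds a \<times>\<^sub>F nhds b. fst p $ n = a $ n"
      "\<forall>\<^sub>F p in nhds a \<times>\<^sub>F nhds b. snd p $ n = b $ n" for n
    unfolding tendsto_fps_iff by auto
  show "((\<lambda>p. fst p + snd p) \<longlongrightarrow> a + b) (nhds a \<times>\<^sub>F nhds b)"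
  proof (rule tendsto_fpsI)
    fix n
    show "\<forall>\<^sub>F p in nhds a \<times>\<^sub>F nhds b. (fst p + snd p) $ n = (a + b) $ n"
      using ev[of n] by eventually_elim simp
  qed
qed

text \<open>Coefficient \<open>n\<close> of a product involves only coefficients up to
  \<open>n\<close>, so finitely many eventual conditions suffice.\<close>

instance fps :: (ring) topological_semigroup_mult
proof
  fix a b :: "'a fps"
  have "((\<lambda>p. fst p) \<longlongrightarrow> a) (nhds a \<times>\<^sub>F nhds b)" "((\<lambda>p. snd p) \<longlongrightarrow> b) (nhds a \<times>\<^sub>F nhds b)"
    by (rule filterlim_fst, rule filterlim_snd)
  then have ev: "\<forall>\<^sub>F p in nhds a \<times>\<^sub>F nhds b. \<forall>k\<in>{..n}. fst p $ k = a $ k"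
      "\<forall>\<^sub>F p in nhds a \<times>\<^sub>F nhds b. \<forall>k\<in>{..n}. snd p $ k = b $ k" for n
    unfolding tendsto_fps_iff by (auto intro!: eventually_ball_finite)
  show "((\<lambda>p. fst p * snd p) \<longlongrightarrow> a * b) (nhds a \<times>\<^sub>F nhds b)"
  proof (rule tendsto_fpsI)
    fix n
    show "\<forall>\<^sub>F p in nhds a \<times>\<^sub>F nhds b. (fst p * snd p) $ n = (a * b) $ n"
      using ev[of n] by eventually_elim (simp add: fps_mult_nth)
  qed
qed

lemma summable_on_fpsI:
  fixes f :: "'a \<Rightarrow> 'b::ab_group_add fps"
  assumes "\<And>n. finite {x \<in> A. f x $ n \<noteq> 0}"
  shows "f summable_on A"
proof -
  have "(f has_sum Abs_fps (\<lambda>n. \<Sum>x | x \<in> A \<and> f x $ n \<noteq> 0. f x $ n)) A"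
    by (rule has_sum_fpsI) (use assms in auto)
  then show ?thesis by (auto simp: summable_on_def)
qed

text \<open>Summing over \<open>B\<close> and then over \<open>A\<close> gives \<open>s * t\<close>.
  For joint summability, a nonzero coefficient \<open>n\<close> of \<open>f x * g y\<close> forces
  nonzero coefficients \<open>i\<close> and \<open>n - i\<close> of the factors for some
  \<open>i\<close>, so only finitely many pairs contribute.\<close>

lemma has_sum_fps_mult:
  fixes f :: "'a \<Rightarrow> 'c::comm_ring_1 fps" and g :: "'b \<Rightarrow> 'c fps"
  assumes f: "(f has_sum s) A" and g: "(g has_sum t) B"
  shows "((\<lambda>(x, y). f x * g y) has_sum (s * t)) (A \<times> B)"
proof (rule has_sum_SigmaI)
  show "((\<lambda>y. case (x, y) of (x, y) \<Rightarrow> f x * g y) has_sum (f x * t)) B" for x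
    using has_sum_cmult_right[OF g, of "f x"] by simp
  show "((\<lambda>x. f x * t) has_sum (s * t)) A"
    by (rule has_sum_cmult_left[OF f])
  show "(\<lambda>(x, y). f x * g y) summable_on A \<times> B"
  proof (rule summable_on_fpsI)
    fix n
    let ?C = "\<Union>i\<le>n. {x \<in> A. f x $ i \<noteq> 0} \<times> {y \<in> B. g y $ (n - i) \<noteq> 0}"
    have "{p \<in> A \<times> B. (case p of (x, y) \<Rightarrow> f x * g y) $ n \<noteq> 0} \<subseteq> ?C"
    proof safe
      fix x y assume xy: "x \<in> A" "y \<in> B" and "(f x * g y) $ n \<noteq> 0"
      then obtain i where "i \<in> {0..n}" "f x $ i * g y $ (n - i) \<noteq> 0"
        unfolding fps_mult_nth by (meson sum.neutral)
      then have "f x $ i \<noteq> 0" "g y $ (n - i) \<noteq> 0" "i \<le> n" by auto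
      with xy show "(x, y) \<in> ?C" by auto
    qed
    moreover have "finite ?C"
      using has_sum_fpsD(1)[OF f] has_sum_fpsD(1)[OF g] by auto
    ultimately show "finite {p \<in> A \<times> B. (case p of (x, y) \<Rightarrow> f x * g y) $ n \<noteq> 0}"
      by (rule finite_subset)
  qed
qed

text \<open>Without a constant term in \<open>x\<close>, the power \<open>x ^ k\<close> starts at
  degree \<open>k\<close> or later. Splitting off \<open>k = 0\<close> gives
  \<open>g = 1 + x * g\<close>. The inverse is given by an equation because the coefficients form
  only a ring.\<close>

lemma has_sum_fps_geometric:
  fixes x :: "'a::comm_ring_1 fps"
  assumes "x $ 0 = 0"
  obtains g where "((\<lambda>k. x ^ k) has_sum g) UNIV" "g * (1 - x) = 1"
proof -
  have "(\<lambda>k. x ^ k) summable_on UNIV"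
  proof (rule summable_on_fpsI)
    fix n
    have "{k \<in> UNIV. (x ^ k) $ n \<noteq> 0} \<subseteq> {..n}"
      using startsby_zero_power_prefix[OF assms] by (auto simp: not_le[symmetric])
    then show "finite {k \<in> UNIV. (x ^ k) $ n \<noteq> 0}"
      by (rule finite_subset) simp
  qed
  then obtain g where g: "((\<lambda>k. x ^ k) has_sum g) UNIV" by (auto simp: summable_on_def)
  have "((\<lambda>k. x ^ k) has_sum (x * g)) (range Suc)"
    by (subst has_sum_reindex) (use has_sum_cmult_right[OF g, of x] in \<open>auto simp: o_def\<close>)
  then have "((\<lambda>k. x ^ k) has_sum (x ^ 0 + x * g)) (insert 0 (range Suc))"
    by (intro has_sum_insert) auto
  then have "((\<lambda>k. x ^ k) has_sum (1 + x * g)) UNIV"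
    by (simp add: UNIV_nat_eq[symmetric])
  from has_sum_unique[OF this g] have "g * (1 - x) = 1"
    by (simp add: algebra_simps)
  with g show ?thesis by (rule that)
qed

text \<open>Leads from a sum over lists to the two series of each identity: group by length, then
  separate even from odd lengths. \<open>r n\<close> is the closed form for length \<open>n\<close>
  in the Laurent field.\<close>

lemma fps_sum_by_parity:
  fixes f :: "'a list \<Rightarrow> int poly fps"
  assumes fin: "\<And>n. finite {l \<in> G. f l $ n \<noteq> 0}"
    and len: "\<And>n. \<exists>s. (f has_sum s) {l \<in> G. length l = n} \<and> emb s = r n"
  shows "\<exists>s t. series_sums (\<lambda>n. r (2 * n)) s \<and> series_sums (\<lambda>n. r (2 * n + 1)) t \<and>
    (f has_sum (s + t)) G"
proof -
  obtain A where A: "\<And>n. (f has_sum A n) {l \<in> G. length l = n}" and r: "\<And>n. emb (A n) = r n"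
    using len by metis
  have part: "\<exists>s. (f has_sum s) {l \<in> G. length l \<in> range h} \<and> series_sums (\<lambda>n. r (h n)) s"
    if h: "inj h" for h
  proof -
    let ?B = "\<lambda>n. {l \<in> G. length l = h n}"
    have "f summable_on {l \<in> G. length l \<in> range h}"
      by (rule summable_on_fpsI) (rule finite_subset[OF _ fin], auto)
    then obtain s where s: "(f has_sum s) {l \<in> G. length l \<in> range h}"
      by (auto simp: summable_on_def)
    \<comment> \<open>\<open>snd\<close> drops the index \<open>n\<close>, which the length
      determines because \<open>h\<close> is injective. Now the sum can be taken over
      \<open>n\<close> first.\<close>
    have "((f \<circ> snd) has_sum s) (Sigma UNIV ?B)"
    proof (subst has_sum_reindex[symmetric])
      show "inj_on snd (Sigma UNIV ?B)"
        using h by (auto simp: inj_on_def)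
      have "snd ` Sigma UNIV ?B = {l \<in> G. length l \<in> range h}"
        by (auto simp: image_iff)
      with s show "(f has_sum s) (snd ` Sigma UNIV ?B)" by simp
    qed
    then have "((\<lambda>n. A (h n)) has_sum s) UNIV"
      by (rule has_sum_SigmaD) (use A in auto)
    then have "(\<lambda>n. A (h n)) sums s" by (rule has_sum_imp_sums)
    then have "series_sums (\<lambda>n. r (h n)) s"
      using r unfolding series_sums_def by (intro exI[of _ "\<lambda>n. A (h n)"]) simp
    with s show ?thesis by blast
  qed
  obtain s where s: "(f has_sum s) {l \<in> G. length l \<in> range (\<lambda>n. 2 * n)}"
      "series_sums (\<lambda>n. r (2 * n)) s"
    using part[of "\<lambda>n. 2 * n"] by (auto simp: inj_def)
  obtain t where t: "(f has_sum t) {l \<in> G. length l \<in> range (\<lambda>n. 2 * n + 1)}"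
      "series_sums (\<lambda>n. r (2 * n + 1)) t"
    using part[of "\<lambda>n. 2 * n + 1"] by (auto simp: inj_def)
  have "(f has_sum (s + t)) ({l \<in> G. length l \<in> range (\<lambda>n. 2 * n)} \<union>
      {l \<in> G. length l \<in> range (\<lambda>n. 2 * n + 1)})"
    using s(1) t(1) by (rule has_sum_Un_disjoint) (auto, presburger)
  also have "{l \<in> G. length l \<in> range (\<lambda>n. 2 * n)} \<union>
      {l \<in> G. length l \<in> range (\<lambda>n. 2 * n + 1)} = G"
    by (auto simp: image_iff) presburger
  finally show ?thesis using s(2) t(2) by blast
qed

section \<open>Partitions and their gaps\<close>

text \<open>The value 0 at \<open>[]\<close> realises the convention that parts beyond the length
  vanish, so the last gap is the last part.\<close>

definition first_part :: "nat list \<Rightarrow> nat" where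
  "first_part l = (if l = [] then 0 else hd l)"

lemma first_part_simps [simp]: "first_part [] = 0" "first_part (a # l) = a"
  by (simp_all add: first_part_def)

text \<open>Gaps are counted from 1, which keeps \<open>u 0\<close> free for
  \<open>parity_weight\<close>.\<close>

fun diff_weight :: "(nat \<Rightarrow> 'a::comm_monoid_mult) \<Rightarrow> nat list \<Rightarrow> 'a" where
  "diff_weight u [] = 1"
| "diff_weight u (a # l) = u 1 ^ (a - first_part l) * diff_weight (u \<circ> Suc) l"

text \<open>The weight \<open>u 0\<close> of the parity of the largest part records how that parity enters the
  gap to a part put in front, which makes the sum over one more part factor.\<close>

definition parity_weight :: "(nat \<Rightarrow> 'a::comm_monoid_mult) \<Rightarrow> nat list \<Rightarrow> 'a" where
  "parity_weight u l = u 0 ^ (first_part l mod 2) * diff_weight u l"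

lemma G1_Nil [simp]: "[] \<in> G1" and G2_Nil [simp]: "[] \<in> G2"
  by (simp_all add: G1_def G2_def is_partition_def)

lemma G1_singleton [simp]: "[a] \<in> G1 \<longleftrightarrow> 1 \<le> a"
  by (auto simp: G1_def is_partition_def)

lemma G2_singleton [simp]: "[a] \<in> G2 \<longleftrightarrow> 2 \<le> a"
  by (auto simp: G2_def)

lemma G1_Cons_Cons:
  "a # b # l \<in> G1 \<longleftrightarrow> b # l \<in> G1 \<and> b + 2 \<le> a \<and> (odd a \<longrightarrow> b + 3 \<le> a)"
proof -
  define gap where "gap l i \<longleftrightarrow> (Suc i < length l \<longrightarrow>
    l ! i \<ge> l ! Suc i + 2 \<and> (odd (l ! i) \<longrightarrow> l ! i \<ge> l ! Suc i + 3))" for l :: "nat list" and i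
  have G1: "m \<in> G1 \<longleftrightarrow> is_partition m \<and> (\<forall>i. gap m i)" for m
    by (simp add: G1_def gap_def)
  have "gap (a # b # l) (Suc i) \<longleftrightarrow> gap (b # l) i" for i
    by (simp add: gap_def)
  then have "(\<forall>i. gap (a # b # l) i) \<longleftrightarrow> gap (a # b # l) 0 \<and> (\<forall>i. gap (b # l) i)"
    by (metis not0_implies_Suc)
  moreover have "gap (a # b # l) 0 \<longleftrightarrow> b + 2 \<le> a \<and> (odd a \<longrightarrow> b + 3 \<le> a)"
    by (simp add: gap_def)
  moreover have "is_partition (a # b # l) \<longleftrightarrow> is_partition (b # l) \<and> b \<le> a"
    by (auto simp: is_partition_def)
  moreover have "b + 2 \<le> a \<Longrightarrow> b \<le> a"
    by simp
  ultimately show ?thesis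
    unfolding G1 by blast
qed

text \<open>The parity condition defining \<^const>\<open>G1\<close> only raises the minimal gap to the least
  value of the right parity, and this gap is symmetric in the two parities.\<close>

lemma gap_iff:
  fixes a b :: nat
  shows "b + 2 \<le> a \<and> (odd a \<longrightarrow> b + 3 \<le> a) \<longleftrightarrow>
    (\<exists>e k. e < 2 \<and> a = b + 2 + b mod 2 + e + 2 * k)"
proof
  assume "b + 2 \<le> a \<and> (odd a \<longrightarrow> b + 3 \<le> a)"
  then show "\<exists>e k. e < 2 \<and> a = b + 2 + b mod 2 + e + 2 * k"
    by (intro exI[of _ "a mod 2"] exI[of _ "a div 2 - b div 2 - b mod 2 - 1"])
      (cases "even a"; cases "even b"; auto elim!: evenE oddE)
next
  assume "\<exists>e k. e < 2 \<and> a = b + 2 + b mod 2 + e + 2 * k"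
  then obtain e k where a: "a = b + 2 + b mod 2 + e + 2 * k" by blast
  then have "b + 3 \<le> a \<or> a = b + 2 \<and> b mod 2 = 0" by arith
  with a show "b + 2 \<le> a \<and> (odd a \<longrightarrow> b + 3 \<le> a)" by auto
qed

text \<open>\<open>first_part l + first_part l mod 2\<close> is even, so the new part has parity
  \<open>e\<close>. The old parity enters the new gap as a power of \<open>u 1\<close>, which is the
  index 0 weight of the shifted sequence and completes
  \<open>parity_weight (u \<circ> Suc) l\<close>.\<close>

lemma parity_weight_Cons:
  assumes "e < 2"
  shows "parity_weight u ((first_part l + 2 + first_part l mod 2 + e + 2 * k) # l) =
    (u 0 * u 1) ^ e * (u 1 ^ 2) * (u 1 ^ 2) ^ k * parity_weight (u \<circ> Suc) l"
proof -
  let ?b = "first_part l"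
  let ?a = "?b + 2 + ?b mod 2 + e + 2 * k"
  have "even (?b + ?b mod 2)" by simp
  then obtain c where "?b + ?b mod 2 = 2 * c" by (rule evenE)
  then have "?a = e + (c + 1 + k) * 2" by simp
  then have "?a mod 2 = e"
    using assms by (simp only: mod_mult_self1 mod_less)
  moreover have "?a - ?b = ?b mod 2 + 2 + e + 2 * k"
    by arith
  moreover have "u 1 ^ (?b mod 2 + 2 + e + 2 * k) =
      u 1 ^ (?b mod 2) * u 1 ^ 2 * u 1 ^ e * (u 1 ^ 2) ^ k"
    by (simp only: power_add power_mult)
  ultimately have "parity_weight u (?a # l) =
      u 0 ^ e * ((u 1 ^ (?b mod 2) * u 1 ^ 2 * u 1 ^ e * (u 1 ^ 2) ^ k) * diff_weight (u \<circ> Suc) l)"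
    by (simp only: parity_weight_def diff_weight.simps first_part_simps)
  also have "\<dots> = (u 0 * u 1) ^ e * (u 1 ^ 2) * (u 1 ^ 2) ^ k * parity_weight (u \<circ> Suc) l"
    unfolding parity_weight_def power_mult_distrib o_apply One_nat_def
    by (simp only: ac_simps)
  finally show ?thesis .
qed

section \<open>Sums over partitions of fixed length\<close>

lemma has_sum_power_01:
  "((\<lambda>e. x ^ e) has_sum (1 + x)) {0, 1 :: nat}" for x :: "'a::comm_ring_1 fps"
  by (rule has_sum_finiteI) auto

text \<open>Prepending a part amounts to a free choice of \<open>e\<close>, \<open>k\<close> and the
  tail \<open>l\<close>, so the sum factors: \<open>e\<close> gives \<open>1 + u 0 * u 1\<close>,
  \<open>k\<close> the geometric series \<open>g\<close>, and \<open>l\<close> the sum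
  \<open>t\<close>.\<close>

lemma parity_weight_Cons_has_sum:
  fixes u :: "nat \<Rightarrow> 'a::comm_ring_1 fps"
  assumes t: "(parity_weight (u \<circ> Suc) has_sum t) B"
    and g: "((\<lambda>k. (u 1 ^ 2) ^ k) has_sum g) UNIV"
    and A: "\<And>a l. a # l \<in> A \<longleftrightarrow>
      l \<in> B \<and> first_part l + 2 \<le> a \<and> (odd a \<longrightarrow> first_part l + 3 \<le> a)"
    and ne: "[] \<notin> A"
  shows "(parity_weight u has_sum (u 1 ^ 2 * (1 + u 0 * u 1) * g * t)) A"
proof -
  define f where "f = (\<lambda>((e, k), l). u 1 ^ 2 *
    ((u 0 * u 1) ^ e * (u 1 ^ 2) ^ k * parity_weight (u \<circ> Suc) l))"
  define i where "i = (\<lambda>((e, k), l). (first_part l + 2 + first_part l mod 2 + e + 2 * k) # l)"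
  define I where "I = ({0 :: nat, 1} \<times> (UNIV :: nat set)) \<times> B"
  have "((\<lambda>p. u 1 ^ 2 * ((\<lambda>(p, l). (\<lambda>(e, k). (u 0 * u 1) ^ e * (u 1 ^ 2) ^ k) p *
      parity_weight (u \<circ> Suc) l) p)) has_sum (u 1 ^ 2 * (((1 + u 0 * u 1) * g) * t))) I"
    unfolding I_def by (intro has_sum_cmult_right has_sum_fps_mult has_sum_power_01 g t)
  then have "(f has_sum (u 1 ^ 2 * (1 + u 0 * u 1) * g * t)) I"
    by (simp add: f_def case_prod_unfold mult.assoc)
  moreover have "f p = parity_weight u (i p)" if p: "p \<in> I" for p
    using p parity_weight_Cons[of 0 u] parity_weight_Cons[of 1 u]
    by (auto simp: f_def i_def I_def ac_simps)
  then have "(f has_sum S) I \<longleftrightarrow> ((\<lambda>p. parity_weight u (i p)) has_sum S) I" for S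
    by (rule has_sum_cong)
  ultimately have "((\<lambda>p. parity_weight u (i p)) has_sum (u 1 ^ 2 * (1 + u 0 * u 1) * g * t)) I"
    by blast
  moreover have i: "bij_betw i I A"
  proof (rule bij_betwI')
    fix p q assume pq: "p \<in> I" "q \<in> I"
    obtain e k l where p: "p = ((e, k), l)" "e = 0 \<or> e = 1" using pq by (auto simp: I_def)
    obtain e' k' l' where q: "q = ((e', k'), l')" "e' = 0 \<or> e' = 1"
      using pq by (auto simp: I_def)
    have "e = e' \<and> k = k'" if "e + 2 * k = e' + 2 * k'"
      using that p(2) q(2) by presburger
    then show "i p = i q \<longleftrightarrow> p = q"
      by (auto simp: i_def p(1) q(1))
  next
    fix p assume "p \<in> I"
    then obtain e k l where p: "p = ((e, k), l)" "e < 2" "l \<in> B" by (auto simp: I_def)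
    have "\<exists>e' k'. e' < 2 \<and> first_part l + 2 + first_part l mod 2 + e + 2 * k =
        first_part l + 2 + first_part l mod 2 + e' + 2 * k'"
      using p(2) by blast
    then show "i p \<in> A"
      unfolding p(1) i_def prod.case A gap_iff using p(3) by blast
  next
    fix x assume x: "x \<in> A"
    then obtain a l where al: "x = a # l" using ne by (cases x) auto
    obtain e k where ek: "e < 2" "a = first_part l + 2 + first_part l mod 2 + e + 2 * k"
      and l: "l \<in> B"
      using x unfolding al A gap_iff by blast
    show "\<exists>p\<in>I. x = i p"
      by (rule bexI[of _ "((e, k), l)"]) (use ek l in \<open>auto simp: al i_def I_def\<close>)
  qed
  ultimately show ?thesis
    using has_sum_reindex_bij_betw[OF i] by blast
qed

text \<open>Base case for \<open>G1\<close>: a single part is \<open>2 - e + 2 * k\<close>. The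
  numerator is left as \<open>u 1 ^ 2 + u 0 * u 1\<close>, since a quotient \<open>u 0 / u 1\<close>
  need not exist in this ring.\<close>

lemma parity_weight_singletons_has_sum:
  fixes u :: "nat \<Rightarrow> 'a::comm_ring_1 fps"
  assumes g: "((\<lambda>k. (u 1 ^ 2) ^ k) has_sum g) UNIV"
  shows "(parity_weight u has_sum ((u 1 ^ 2 + u 0 * u 1) * g)) {[a] | a. 1 \<le> a}"
proof -
  define f where "f = (\<lambda>(e :: nat, k). (if e = 0 then u 1 ^ 2 else u 0 * u 1) * (u 1 ^ 2) ^ k)"
  define i where "i = (\<lambda>(e :: nat, k :: nat). [2 - e + 2 * k])"
  define I where "I = {0 :: nat, 1} \<times> (UNIV :: nat set)"
  have "((\<lambda>e::nat. if e = 0 then u 1 ^ 2 else u 0 * u 1) has_sum (u 1 ^ 2 + u 0 * u 1)) {0, 1}"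
    by (rule has_sum_finiteI) simp_all
  then have "(f has_sum ((u 1 ^ 2 + u 0 * u 1) * g)) I"
    unfolding f_def I_def using g by (rule has_sum_fps_mult)
  moreover have "f p = parity_weight u (i p)" if "p \<in> I" for p
  proof -
    from that consider k where "p = (0, k)" | k where "p = (1, k)" by (auto simp: I_def)
    then show ?thesis
    proof cases
      case (1 k)
      have "f p = u 1 ^ 2 * (u 1 ^ 2) ^ k" by (simp add: 1 f_def)
      also have "\<dots> = u 1 ^ (2 + 2 * k)" by (simp only: power_add power_mult)
      also have "\<dots> = parity_weight u (i p)" by (simp add: 1 i_def parity_weight_def)
      finally show ?thesis .
    next
      case (2 k)
      then show ?thesis by (simp add: f_def i_def parity_weight_def power_mult mult.assoc)
    qed
  qed
  then have "(f has_sum S) I \<longleftrightarrow> ((\<lambda>p. parity_weight u (i p)) has_sum S) I" for S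
    by (rule has_sum_cong)
  ultimately have "((\<lambda>p. parity_weight u (i p)) has_sum ((u 1 ^ 2 + u 0 * u 1) * g)) I"
    by blast
  moreover have i: "bij_betw i I {[a] | a. 1 \<le> a}"
  proof (rule bij_betwI')
    fix p q assume pq: "p \<in> I" "q \<in> I"
    obtain e k where p: "p = (e, k)" "e = 0 \<or> e = 1" using pq by (auto simp: I_def)
    obtain e' k' where q: "q = (e', k')" "e' = 0 \<or> e' = 1" using pq by (auto simp: I_def)
    have "e = e' \<and> k = k'" if "2 - e + 2 * k = 2 - e' + 2 * k'"
      using that p(2) q(2) by presburger
    then show "i p = i q \<longleftrightarrow> p = q"
      by (auto simp: i_def p(1) q(1))
  next
    fix p assume "p \<in> I"
    then show "i p \<in> {[a] | a. 1 \<le> a}" by (auto simp: i_def I_def)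
  next
    fix x assume "x \<in> {[a] | a::nat. 1 \<le> a}"
    then obtain a where a: "x = [Suc a]" by (auto simp: Suc_le_eq gr0_conv_Suc)
    show "\<exists>p\<in>I. x = i p"
    \<comment> \<open>The part is \<open>Suc a\<close>, so its parity \<open>e\<close> is opposite
      to that of \<open>a\<close>.\<close>
    proof (cases "even a")
      case True
      then show ?thesis
        by (intro bexI[of _ "(1, a div 2)"]) (simp_all add: a i_def I_def)
    next
      case False
      then show ?thesis
        by (intro bexI[of _ "(0, a div 2)"]) (simp_all add: a i_def I_def odd_two_times_div_two_nat)
    qed
  qed
  ultimately show ?thesis
    using has_sum_reindex_bij_betw[OF i] by blast
qed

definition pair_factor :: "(nat \<Rightarrow> 'a::field) \<Rightarrow> nat \<Rightarrow> 'a" where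
  "pair_factor v i = v (Suc i) ^ 2 * (1 + v i * v (Suc i)) / (1 - v (Suc i) ^ 2)"

lemma prod_pair_factor_shift:
  "(\<Prod>i<Suc n. pair_factor v i) = pair_factor v 0 * (\<Prod>i<n. pair_factor (v \<circ> Suc) i)"
  by (subst prod.lessThan_Suc_shift) (simp add: pair_factor_def)

text \<open>The relation itself makes \<open>1 - emb x\<close> nonzero, so the quotient is a genuine
  one.\<close>

lemma emb_geometric:
  assumes "g * (1 - x) = 1"
  shows "emb g = 1 / (1 - emb x)"
proof -
  have "emb g * emb (1 - x) = 1" using assms by (metis emb_1 emb_mult)
  moreover have "emb (1 - x) = 1 - emb x"
    using emb_add[of "1 - x" x] by (simp add: algebra_simps)
  ultimately show ?thesis by (metis mult_zero_right nonzero_eq_divide_eq zero_neq_one)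
qed

text \<open>For \<open>l = []\<close> the bounds reduce to \<open>2 \<le> a\<close>, as an odd
  \<open>a\<close> is then at least 3. So \<open>G2\<close> behaves as if a part 0 followed, and its
  recursion can start at the empty list; that of \<open>G1\<close> starts at one part.\<close>

lemma G2_Cons_iff:
  "a # l \<in> G2 \<longleftrightarrow>
    l \<in> G2 \<and> first_part l + 2 \<le> a \<and> (odd a \<longrightarrow> first_part l + 3 \<le> a)"
proof (cases l)
  case Nil
  have "odd a \<Longrightarrow> 2 \<le> a \<Longrightarrow> 3 \<le> a" by presburger
  with Nil show ?thesis by auto
qed (auto simp: G2_def G1_Cons_Cons)

lemma G1_Cons_iff:
  assumes "l \<noteq> []"
  shows "a # l \<in> G1 \<longleftrightarrow>
    l \<in> G1 \<and> first_part l + 2 \<le> a \<and> (odd a \<longrightarrow> first_part l + 3 \<le> a)"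
  using assms by (cases l) (auto simp: G1_Cons_Cons)

text \<open>Each step removes the first part and shifts \<open>u\<close>. Index 0 is exempt from the
  vanishing constant term, as \<open>u 0\<close> will be 1.\<close>

lemma parity_weight_G2:
  fixes u :: "nat \<Rightarrow> int poly fps"
  assumes "\<And>i. u (Suc i) $ 0 = 0"
  shows "\<exists>s. (parity_weight u has_sum s) {l \<in> G2. length l = n} \<and>
    emb s = (\<Prod>i<n. pair_factor (emb \<circ> u) i)"
  using assms
proof (induction n arbitrary: u)
  case 0
  have "{l \<in> G2. length l = 0} = {[]}" by auto
  moreover have "(parity_weight u has_sum 1) {[]}"
    by (rule has_sum_finiteI) (simp_all add: parity_weight_def)
  ultimately show ?case by (intro exI[of _ 1]) simp
next
  case (Suc n)
  have "\<exists>t. (parity_weight (u \<circ> Suc) has_sum t) {l \<in> G2. length l = n} \<and>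
      emb t = (\<Prod>i<n. pair_factor (emb \<circ> (u \<circ> Suc)) i)"
    by (rule Suc.IH) (simp add: Suc.prems)
  then obtain t where t: "(parity_weight (u \<circ> Suc) has_sum t) {l \<in> G2. length l = n}"
    "emb t = (\<Prod>i<n. pair_factor (emb \<circ> (u \<circ> Suc)) i)"
    by blast
  obtain g where g: "((\<lambda>k. (u 1 ^ 2) ^ k) has_sum g) UNIV" "g * (1 - u 1 ^ 2) = 1"
    by (rule has_sum_fps_geometric[of "u 1 ^ 2"]) (use Suc.prems[of 0] in simp)
  have "(parity_weight u has_sum (u 1 ^ 2 * (1 + u 0 * u 1) * g * t)) {l \<in> G2. length l = Suc n}"
    by (rule parity_weight_Cons_has_sum[where u = u, OF t(1) g(1)]) (auto simp: G2_Cons_iff)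
  moreover have "emb (u 1 ^ 2 * (1 + u 0 * u 1) * g * t) = (\<Prod>i<Suc n. pair_factor (emb \<circ> u) i)"
    unfolding prod_pair_factor_shift
    by (simp add: emb_geometric[OF g(2)] t(2) pair_factor_def o_assoc)
  ultimately show ?case by blast
qed

text \<open>The recursion is that of \<open>G2\<close>, but it starts at length one, where the last
  part has its own factor.\<close>

lemma parity_weight_G1:
  fixes u :: "nat \<Rightarrow> int poly fps"
  assumes "\<And>i. u (Suc i) $ 0 = 0" and v: "v = emb \<circ> u"
  shows "\<exists>s. (parity_weight u has_sum s) {l \<in> G1. length l = Suc n} \<and>
    emb s = (\<Prod>i<n. pair_factor v i) *
      ((v (Suc n) ^ 2 + v n * v (Suc n)) / (1 - v (Suc n) ^ 2))"
  using assms
proof (induction n arbitrary: u v)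
  case 0
  obtain g where g: "((\<lambda>k. (u 1 ^ 2) ^ k) has_sum g) UNIV" "g * (1 - u 1 ^ 2) = 1"
    by (rule has_sum_fps_geometric[of "u 1 ^ 2"]) (use 0(1)[of 0] in simp)
  have "{l \<in> G1. length l = Suc 0} = {[a] | a. 1 \<le> a}"
    by (auto simp: length_Suc_conv)
  with parity_weight_singletons_has_sum[where u = u, OF g(1)] show ?case
    by (intro exI[of _ "(u 1 ^ 2 + u 0 * u 1) * g"])
      (simp add: emb_geometric[OF g(2)] 0(2))
next
  case (Suc n)
  have "\<exists>t. (parity_weight (u \<circ> Suc) has_sum t) {l \<in> G1. length l = Suc n} \<and>
      emb t = (\<Prod>i<n. pair_factor (v \<circ> Suc) i) * (((v \<circ> Suc) (Suc n) ^ 2 +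
        (v \<circ> Suc) n * (v \<circ> Suc) (Suc n)) / (1 - (v \<circ> Suc) (Suc n) ^ 2))"
    by (rule Suc.IH) (simp_all add: Suc.prems o_assoc)
  then obtain t where t: "(parity_weight (u \<circ> Suc) has_sum t) {l \<in> G1. length l = Suc n}"
    "emb t = (\<Prod>i<n. pair_factor (v \<circ> Suc) i) *
      ((v (Suc (Suc n)) ^ 2 + v (Suc n) * v (Suc (Suc n))) / (1 - v (Suc (Suc n)) ^ 2))"
    by auto
  obtain g where g: "((\<lambda>k. (u 1 ^ 2) ^ k) has_sum g) UNIV" "g * (1 - u 1 ^ 2) = 1"
    by (rule has_sum_fps_geometric[of "u 1 ^ 2"]) (use Suc.prems(1)[of 0] in simp)
  have "a # l \<in> {l \<in> G1. length l = Suc (Suc n)} \<longleftrightarrow> l \<in> {l \<in> G1. length l = Suc n} \<and>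
      first_part l + 2 \<le> a \<and> (odd a \<longrightarrow> first_part l + 3 \<le> a)" for a l
    by (cases "l = []") (auto simp: G1_Cons_iff)
  then have "(parity_weight u has_sum (u 1 ^ 2 * (1 + u 0 * u 1) * g * t))
      {l \<in> G1. length l = Suc (Suc n)}"
    by (rule parity_weight_Cons_has_sum[where u = u, OF t(1) g(1)]) simp
  moreover have "emb (u 1 ^ 2 * (1 + u 0 * u 1) * g * t) = (\<Prod>i<Suc n. pair_factor v i) *
      ((v (Suc (Suc n)) ^ 2 + v (Suc n) * v (Suc (Suc n))) / (1 - v (Suc (Suc n)) ^ 2))"
    unfolding prod_pair_factor_shift
    by (simp add: emb_geometric[OF g(2)] t(2) pair_factor_def Suc.prems(2))
  ultimately show ?case by blast
qed

section \<open>Statistics as linear forms in the gaps\<close>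

fun diff_sum :: "(nat \<Rightarrow> nat) \<Rightarrow> nat list \<Rightarrow> nat" where
  "diff_sum c [] = 0"
| "diff_sum c (a # l) = c 0 * (a - first_part l) + diff_sum (c \<circ> Suc) l"

lemma zq_monom_mult: "zq_monom a w * zq_monom a' w' = zq_monom (a + a') (w + w')"
proof -
  have "emb (zq_monom a w * zq_monom a' w') = emb (zq_monom (a + a') (w + w'))"
    by (simp only: emb_mult emb_zq_monom power_add ac_simps)
  then show ?thesis by (simp only: emb_eq_iff)
qed

lemma zq_monom_0 [simp]: "zq_monom 0 0 = 1"
  by (simp add: zq_monom_def)

lemma zq_monom_power: "zq_monom a w ^ n = zq_monom (a * n) (w * n)"
  by (induction n) (simp_all add: zq_monom_mult)

lemma zq_monom_nth: "zq_monom a w $ n = (if n = w then monom 1 a else 0)"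
  by (simp add: zq_monom_def)

lemma diff_weight_zq_monom:
  "diff_weight (\<lambda>i. zq_monom (c i) (d i)) l = zq_monom (diff_sum (c \<circ> Suc) l) (diff_sum (d \<circ> Suc) l)"
  by (induction l arbitrary: c d)
    (simp_all add: zq_monom_power zq_monom_mult o_def)

text \<open>Abel summation; the initial value \<open>r\<close> is what makes the induction work.\<close>

lemma diff_sum_eq:
  assumes "sorted_wrt (\<ge>) l" "int (c 0) = r + b 0" "\<And>i. int (c (Suc i)) = int (c i) + b (Suc i)"
  shows "int (diff_sum c l) = (\<Sum>i<length l. b i * int (l ! i)) + r * int (first_part l)"
  using assms
proof (induction l arbitrary: b c r)
  case (Cons a l)
  \<comment> \<open>The tail takes \<open>c 0\<close> as its initial value; adding
    \<open>c 0 * (a - first_part l)\<close> leaves \<open>c 0 * a\<close>, that is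
    \<open>(r + b 0) * a\<close>.\<close>
  have "int (diff_sum (c \<circ> Suc) l) =
      (\<Sum>i<length l. (b \<circ> Suc) i * int (l ! i)) + int (c 0) * int (first_part l)"
    by (rule Cons.IH) (use Cons.prems in auto)
  moreover have "first_part l \<le> a"
    using Cons.prems(1) by (cases l) auto
  then obtain d where "a = first_part l + d" by (auto simp: le_iff_add)
  ultimately show ?case
    using Cons.prems(2)
    by (simp add: sum.lessThan_Suc_shift algebra_simps del: sum.lessThan_Suc)
qed simp

lemma G1_sorted: "l \<in> G1 \<Longrightarrow> sorted_wrt (>) l"
proof (induction l)
  case (Cons a l)
  show ?case
  proof (cases l)
    case (Cons b m)
    with Cons.prems Cons.IH show ?thesis by (auto simp: G1_Cons_Cons)
  qed simp
qed simp

text \<open>The gaps add up to the first part. Hence the exponent of \<open>q\<close> bounds all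
  parts.\<close>

lemma first_part_le_diff_sum:
  assumes "\<And>i. 0 < c i"
  shows "first_part l \<le> diff_sum c l"
  using assms
proof (induction l arbitrary: c)
  case (Cons a l)
  have "first_part l \<le> diff_sum (c \<circ> Suc) l"
    by (rule Cons.IH) (simp add: Cons.prems)
  moreover have "a - first_part l \<le> c 0 * (a - first_part l)"
    using mult_le_mono1[of 1 "c 0"] Cons.prems[of 0] by simp
  ultimately show ?case
    unfolding first_part_simps diff_sum.simps by linarith
qed simp

text \<open>Parts in \<open>G1\<close> are distinct, and there are finitely many lists of distinct
  numbers up to \<open>n\<close>.\<close>

lemma finite_G1_first_part_le: "finite {l \<in> G1. first_part l \<le> n}"
proof (rule finite_subset[OF _ finite_subset_distinct[of "{..n}"]])
  have "set l \<subseteq> {..n} \<and> distinct l" if "l \<in> G1" "first_part l \<le> n" for l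
  proof -
    have "sorted_wrt (>) l" using that(1) by (rule G1_sorted)
    moreover from this have "distinct l" by (induction l) auto
    ultimately show ?thesis using that(2) by (cases l) auto
  qed
  then show "{l \<in> G1. first_part l \<le> n} \<subseteq> {xs. set xs \<subseteq> {..n} \<and> distinct xs}"
    by blast
qed simp

text \<open>This is the monomial \<open>u\<^sub>i\<close> of gap \<open>i\<close>. The alternating
  sum adds the gaps of odd index, hence the \<open>Z\<close>. The exponent \<open>e i\<close> will
  be \<open>i\<close> for the weight and \<open>Suc i div 2\<close> for the Schmidt weight.\<close>

definition step_monom :: "(nat \<Rightarrow> nat) \<Rightarrow> nat \<Rightarrow> laurent" where
  "step_monom e i = Z ^ of_bool (odd i) * Q ^ e i"

text \<open>Squares, cross terms and denominators are separated to match the shape of the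
  identities: a monomial, a Pochhammer numerator and Pochhammer denominators.\<close>

definition square_prod :: "(nat \<Rightarrow> 'a::comm_ring_1) \<Rightarrow> nat \<Rightarrow> 'a" where
  "square_prod v n = (\<Prod>i<n. v (Suc i) ^ 2)"

definition cross_prod :: "(nat \<Rightarrow> 'a::comm_ring_1) \<Rightarrow> nat \<Rightarrow> 'a" where
  "cross_prod v n = (\<Prod>i<n. 1 + v i * v (Suc i))"

definition den_prod :: "(nat \<Rightarrow> 'a::comm_ring_1) \<Rightarrow> nat \<Rightarrow> 'a" where
  "den_prod v n = (\<Prod>i<n. 1 - v (Suc i) ^ 2)"

text \<open>In \<^const>\<open>G1\<close> an odd last part may be as small as \<open>1\<close> instead of \<open>3\<close>, so its parity
  contributes \<open>v m / v n\<close> (with \<open>n = Suc m\<close>) in place of \<open>v m * v n\<close>.\<close>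

definition cross_prod_G1 :: "(nat \<Rightarrow> 'a::field) \<Rightarrow> nat \<Rightarrow> 'a" where
  "cross_prod_G1 v n = (case n of 0 \<Rightarrow> 1 | Suc m \<Rightarrow> cross_prod v m * (1 + v m / v n))"

lemma prod_pair_factor:
  "(\<Prod>i<n. pair_factor v i) = square_prod v n * cross_prod v n / den_prod v n"
  by (simp add: pair_factor_def square_prod_def cross_prod_def den_prod_def prod.distrib prod_dividef)

lemma prods_Suc:
  "square_prod v (Suc n) = square_prod v n * v (Suc n) ^ 2"
  "cross_prod v (Suc n) = cross_prod v n * (1 + v n * v (Suc n))"
  "den_prod v (Suc n) = den_prod v n * (1 - v (Suc n) ^ 2)"
  by (simp_all add: square_prod_def cross_prod_def den_prod_def)

lemma prods_0 [simp]: "square_prod v 0 = 1" "cross_prod v 0 = 1" "den_prod v 0 = 1"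
  by (simp_all add: square_prod_def cross_prod_def den_prod_def)

text \<open>Gap coefficients are partial sums of part coefficients: 1, -1, 1, -1 gives 1, 0, 1, 0.
  In the same way 1, 1, 1 gives 1, 2, 3 for the weight, and 1, 0, 1, 0 gives 1, 1, 2, 2 for the
  Schmidt weight.\<close>

lemma diff_sum_parity:
  assumes "sorted_wrt (\<ge>) l"
  shows "diff_sum (\<lambda>i. of_bool (even i)) l = nat (alt_sum l)"
proof -
  have "int (diff_sum (\<lambda>i. of_bool (even i)) l) =
      (\<Sum>i<length l. (-1) ^ i * int (l ! i)) + 0 * int (first_part l)"
    by (rule diff_sum_eq) (use assms in auto)
  then show ?thesis by (simp add: alt_sum_def)
qed

lemma diff_sum_Suc:
  assumes "sorted_wrt (\<ge>) l"
  shows "diff_sum Suc l = weight l"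
proof -
  have "int (diff_sum Suc l) = (\<Sum>i<length l. 1 * int (l ! i)) + 0 * int (first_part l)"
    by (rule diff_sum_eq) (use assms in auto)
  then have "int (diff_sum Suc l) = int (weight l)"
    by (simp add: sum_list_sum_nth atLeast0LessThan)
  then show ?thesis by simp
qed

lemma diff_sum_half:
  assumes "sorted_wrt (\<ge>) l"
  shows "diff_sum (\<lambda>i. Suc (i div 2)) l = schmidt_weight l"
proof -
  have "int (diff_sum (\<lambda>i. Suc (i div 2)) l) =
      (\<Sum>i<length l. of_bool (even i) * int (l ! i)) + 0 * int (first_part l)"
    by (rule diff_sum_eq) (use assms in \<open>auto elim!: evenE oddE\<close>)
  also have "(\<Sum>i<length l. of_bool (even i) * int (l ! i)) =
      (\<Sum>i | i < length l \<and> even i. int (l ! i))"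
    by (rule sum.mono_neutral_cong_right) auto
  finally have "int (diff_sum (\<lambda>i. Suc (i div 2)) l) = int (schmidt_weight l)"
    by (simp add: schmidt_weight_def)
  then show ?thesis by simp
qed

section \<open>Specialisation of the gap weights to monomials\<close>

lemma Z_nonzero [simp]: "Z \<noteq> 0"
  by (simp add: Z_def fls_const_nonzero)

lemma Q_nonzero [simp]: "Q \<noteq> 0"
  by (simp add: Q_def)

text \<open>With \<open>e 0 = 0\<close> the monomial at index 0 is 1, so the auxiliary parity factor
  disappears.\<close>

lemma parity_weight_step_monom:
  assumes "e 0 = 0" "l \<in> G1"
  shows "parity_weight (\<lambda>i. zq_monom (of_bool (odd i)) (e i)) l =
    zq_monom (nat (alt_sum l)) (diff_sum (e \<circ> Suc) l)"
proof -
  have "sorted_wrt (\<ge>) l"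
    using assms(2) by (simp add: G1_def is_partition_def)
  then show ?thesis
    by (simp add: parity_weight_def diff_weight_zq_monom assms(1) o_def diff_sum_parity)
qed

lemma finite_zq_monom_coeff:
  assumes "\<And>i. 0 < e (Suc i)"
  shows "finite {l \<in> G1. zq_monom (a l) (diff_sum (e \<circ> Suc) l) $ n \<noteq> 0}"
proof (rule finite_subset[OF _ finite_G1_first_part_le[of n]])
  have "first_part l \<le> diff_sum (e \<circ> Suc) l" for l
    by (rule first_part_le_diff_sum) (simp add: assms)
  then show "{l \<in> G1. zq_monom (a l) (diff_sum (e \<circ> Suc) l) $ n \<noteq> 0} \<subseteq> {l \<in> G1. first_part l \<le> n}"
    by (auto simp: zq_monom_nth split: if_splits)
qed

lemma emb_step_monom: "emb \<circ> (\<lambda>i. zq_monom (of_bool (odd i)) (e i)) = step_monom e"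
  by (simp add: fun_eq_iff emb_zq_monom step_monom_def)

text \<open>The exponents \<open>e\<close> stay general, so that weight and Schmidt weight become
  two instances.\<close>

lemma G2_series:
  assumes e: "e 0 = 0" "\<And>i. 0 < e (Suc i)" and v: "v = step_monom e"
    and w: "\<And>l. l \<in> G1 \<Longrightarrow> w l = diff_sum (e \<circ> Suc) l"
  shows "\<exists>s t.
    series_sums (\<lambda>n. square_prod v (2 * n) * cross_prod v (2 * n) / den_prod v (2 * n)) s \<and>
    series_sums (\<lambda>n. square_prod v (2 * n + 1) * cross_prod v (2 * n + 1) / den_prod v (2 * n + 1)) t \<and>
    ((\<lambda>l. zq_monom (nat (alt_sum l)) (w l)) has_sum (s + t)) G2"
proof (rule fps_sum_by_parity)
  let ?f = "\<lambda>l. zq_monom (nat (alt_sum l)) (w l)"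
  let ?u = "\<lambda>i. zq_monom (of_bool (odd i)) (e i)"
  have G: "G2 \<subseteq> G1" by (auto simp: G2_def)
  show "finite {l \<in> G2. ?f l $ n \<noteq> 0}" for n
    by (rule finite_subset[OF _ finite_zq_monom_coeff[of e, OF e(2)]]) (use G w in auto)
  fix n
  have eq: "(?f has_sum s) {l \<in> G2. length l = n} \<longleftrightarrow>
      (parity_weight ?u has_sum s) {l \<in> G2. length l = n}" for s
    by (rule has_sum_cong) (use G w parity_weight_step_monom[of e, OF e(1)] in auto)
  have "?u (Suc i) $ 0 = 0" for i
    using e(2)[of i] by (simp add: zq_monom_nth)
  then have "\<exists>s. (parity_weight ?u has_sum s) {l \<in> G2. length l = n} \<and>
      emb s = (\<Prod>i<n. pair_factor (emb \<circ> ?u) i)"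
    by (rule parity_weight_G2)
  then show "\<exists>s. (?f has_sum s) {l \<in> G2. length l = n} \<and>
      emb s = square_prod v n * cross_prod v n / den_prod v n"
    unfolding emb_step_monom prod_pair_factor v eq .
qed

lemma G1_series:
  assumes e: "e 0 = 0" "\<And>i. 0 < e (Suc i)" and v: "v = step_monom e"
    and w: "\<And>l. l \<in> G1 \<Longrightarrow> w l = diff_sum (e \<circ> Suc) l"
  shows "\<exists>s t.
    series_sums (\<lambda>n. square_prod v (2 * n) * cross_prod_G1 v (2 * n) / den_prod v (2 * n)) s \<and>
    series_sums (\<lambda>n. square_prod v (2 * n + 1) * cross_prod_G1 v (2 * n + 1) /
      den_prod v (2 * n + 1)) t \<and>
    ((\<lambda>l. zq_monom (nat (alt_sum l)) (w l)) has_sum (s + t)) G1"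
proof (rule fps_sum_by_parity)
  let ?f = "\<lambda>l. zq_monom (nat (alt_sum l)) (w l)"
  let ?u = "\<lambda>i. zq_monom (of_bool (odd i)) (e i)"
  show "finite {l \<in> G1. ?f l $ n \<noteq> 0}" for n
    by (rule finite_subset[OF _ finite_zq_monom_coeff[of e, OF e(2)]]) (use w in auto)
  fix n
  have eq: "(?f has_sum s) {l \<in> G1. length l = n} \<longleftrightarrow>
      (parity_weight ?u has_sum s) {l \<in> G1. length l = n}" for s
    by (rule has_sum_cong) (use w parity_weight_step_monom[of e, OF e(1)] in auto)
  show "\<exists>s. (?f has_sum s) {l \<in> G1. length l = n} \<and> emb s = square_prod v n * cross_prod_G1 v n / den_prod v n"
  proof (cases n)
    case 0
    have "{l \<in> G1. length l = n} = {[]}" using 0 by auto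
    moreover have "(?f has_sum 1) {[]}"
      by (rule has_sum_finiteI) (simp_all add: w)
    ultimately show ?thesis
      by (intro exI[of _ 1]) (simp add: 0 cross_prod_G1_def)
  next
    case (Suc m)
    have "?u (Suc i) $ 0 = 0" for i
      using e(2)[of i] by (simp add: zq_monom_nth)
    moreover have "v = emb \<circ> ?u" by (simp add: v emb_step_monom)
    ultimately have "\<exists>s. (parity_weight ?u has_sum s) {l \<in> G1. length l = Suc m} \<and>
        emb s = (\<Prod>i<m. pair_factor v i) *
          ((v (Suc m) ^ 2 + v m * v (Suc m)) / (1 - v (Suc m) ^ 2))"
      by (rule parity_weight_G1)
    \<comment> \<open>In the Laurent field the square can be pulled out, and the quotient
      \<open>v m / v (Suc m)\<close> appears.\<close>
    moreover have "v (Suc m) \<noteq> 0" by (simp add: v step_monom_def)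
    then have "v (Suc m) ^ 2 + v m * v (Suc m) = v (Suc m) ^ 2 * (1 + v m / v (Suc m))"
      by (simp add: field_simps power2_eq_square)
    then have "(\<Prod>i<m. pair_factor v i) *
        ((v (Suc m) ^ 2 + v m * v (Suc m)) / (1 - v (Suc m) ^ 2)) =
        square_prod v n * cross_prod_G1 v n / den_prod v n"
      unfolding prod_pair_factor cross_prod_G1_def Suc prods_Suc nat.case
      by (simp only: times_divide_times_eq ac_simps)
    ultimately show ?thesis
      unfolding eq by (simp add: Suc)
  qed
qed

section \<open>Evaluation of the products\<close>

lemma qpoch_Suc: "qpoch a q (Suc n) = qpoch a q n * (1 - a * q ^ n)"
  by (simp add: qpoch_def)

lemma qpoch_Suc_shift: "qpoch a q (Suc n) = (1 - a) * qpoch (a * q) q n"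
  unfolding qpoch_def by (subst prod.lessThan_Suc_shift) (simp add: mult.assoc)

text \<open>Of two neighbouring indices exactly one is odd, hence a single \<open>Z\<close>; the
  exponents of \<open>Q\<close> add up to \<open>2 * i + 1\<close>.\<close>

lemma cross_prod_weight: "cross_prod (step_monom (\<lambda>i. i)) n = qpoch (- Z * Q) (Q ^ 2) n"
proof -
  have "step_monom (\<lambda>i. i) i * step_monom (\<lambda>i. i) (Suc i) = Z * Q * (Q ^ 2) ^ i" for i
    by (cases "even i") (simp_all add: step_monom_def power_mult[symmetric] mult_2 power_add)
  then show ?thesis by (simp add: cross_prod_def qpoch_def)
qed

text \<open>Here the halved exponents of neighbours add up to \<open>i + 1\<close>, so the base is
  \<open>Q\<close>.\<close>

lemma cross_prod_schmidt:
  "cross_prod (step_monom (\<lambda>i. Suc i div 2)) n = qpoch (- Z * Q) Q n"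
proof -
  have "step_monom (\<lambda>i. Suc i div 2) i * step_monom (\<lambda>i. Suc i div 2) (Suc i) = Z * Q * Q ^ i" for i
  proof (cases "even i")
    case True
    then obtain k where "i = 2 * k" by (rule evenE)
    then show ?thesis by (simp add: step_monom_def mult_2 power_add)
  next
    case False
    then obtain k where "i = 2 * k + 1" by (rule oddE)
    then show ?thesis by (simp add: step_monom_def mult_2 power_add)
  qed
  then show ?thesis by (simp add: cross_prod_def qpoch_def)
qed

lemma step_monom_weight_square:
  "step_monom (\<lambda>i. i) (Suc (2 * n)) ^ 2 = Z ^ 2 * Q ^ (2 * (2 * n + 1))"
  "step_monom (\<lambda>i. i) (Suc (Suc (2 * n))) ^ 2 = Q ^ (2 * (2 * n + 2))"
  by (simp_all add: step_monom_def power_mult_distrib power_mult[symmetric] mult.commute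
      del: power_Suc)

text \<open>The exponent of \<open>Q\<close> is twice the sum of 1 to \<open>2 * n\<close>; each of
  the \<open>n\<close> odd indices gives \<open>Z ^ 2\<close>.\<close>

lemma square_prod_weight_even:
  "square_prod (step_monom (\<lambda>i. i)) (2 * n) = Z ^ (2 * n) * Q ^ (2 * ((2 * n + 1) choose 2))"
proof (induction n)
  case (Suc n)
  have *: "2 * Suc n = Suc (Suc (2 * n))" by simp
  have "2 * ((2 * Suc n + 1) choose 2) = 2 * ((2 * n + 1) choose 2) + 2 * (2 * n + 1) + 2 * (2 * n + 2)"
    by (simp add: numeral_2_eq_2)
  moreover have "2 * Suc n = 2 * n + 2" by simp
  ultimately have "Z ^ (2 * Suc n) * Q ^ (2 * ((2 * Suc n + 1) choose 2)) =
      Z ^ (2 * n) * Q ^ (2 * ((2 * n + 1) choose 2)) * (Z ^ 2 * Q ^ (2 * (2 * n + 1))) *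
        Q ^ (2 * (2 * n + 2))"
    by (simp only: power_add ac_simps)
  with Suc show ?case
    by (simp only: * prods_Suc step_monom_weight_square)
qed (simp add: binomial_eq_0)

lemma square_prod_weight_odd:
  "square_prod (step_monom (\<lambda>i. i)) (2 * n + 1) =
    Z ^ (2 * n + 2) * Q ^ (2 * ((2 * n + 2) choose 2))"
proof -
  have "2 * ((2 * n + 2) choose 2) = 2 * ((2 * n + 1) choose 2) + 2 * (2 * n + 1)"
    by (simp add: numeral_2_eq_2)
  then have "Z ^ (2 * n + 2) * Q ^ (2 * ((2 * n + 2) choose 2)) =
      Z ^ (2 * n) * Q ^ (2 * ((2 * n + 1) choose 2)) * (Z ^ 2 * Q ^ (2 * (2 * n + 1)))"
    by (simp only: power_add ac_simps)
  then show ?thesis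
    by (simp only: Suc_eq_plus1[symmetric] prods_Suc step_monom_weight_square
        square_prod_weight_even)
qed

lemma den_prod_weight_step:
  "step_monom (\<lambda>i. i) (Suc (2 * n)) ^ 2 = Z ^ 2 * Q ^ 2 * (Q ^ 4) ^ n"
  "step_monom (\<lambda>i. i) (Suc (Suc (2 * n))) ^ 2 = Q ^ 4 * (Q ^ 4) ^ n"
proof -
  have "2 * (2 * n + 1) = 2 + 4 * n" "2 * (2 * n + 2) = 4 + 4 * n" by simp_all
  then show "step_monom (\<lambda>i. i) (Suc (2 * n)) ^ 2 = Z ^ 2 * Q ^ 2 * (Q ^ 4) ^ n"
    "step_monom (\<lambda>i. i) (Suc (Suc (2 * n))) ^ 2 = Q ^ 4 * (Q ^ 4) ^ n"
    unfolding step_monom_weight_square by (simp_all only: power_add power_mult mult.assoc)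
qed

text \<open>Even indices give the first symbol and odd indices the one with \<open>Z\<close>; an odd
  length has one more odd index.\<close>

lemma den_prod_weight_even:
  "den_prod (step_monom (\<lambda>i. i)) (2 * n) = qpoch (Q ^ 4) (Q ^ 4) n * qpoch (Z ^ 2 * Q ^ 2) (Q ^ 4) n"
proof (induction n)
  case (Suc n)
  have *: "2 * Suc n = Suc (Suc (2 * n))" by simp
  show ?case
    unfolding * prods_Suc qpoch_Suc den_prod_weight_step Suc.IH by (simp only: ac_simps)
qed (simp add: qpoch_def)

lemma den_prod_weight_odd:
  "den_prod (step_monom (\<lambda>i. i)) (2 * n + 1) =
    qpoch (Q ^ 4) (Q ^ 4) n * qpoch (Z ^ 2 * Q ^ 2) (Q ^ 4) (n + 1)"
  by (simp only: Suc_eq_plus1[symmetric] prods_Suc qpoch_Suc den_prod_weight_step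
      den_prod_weight_even mult.assoc)

lemma step_monom_schmidt_square:
  "step_monom (\<lambda>i. Suc i div 2) (Suc (2 * n)) ^ 2 = Z ^ 2 * Q ^ (2 * (n + 1))"
  "step_monom (\<lambda>i. Suc i div 2) (Suc (Suc (2 * n))) ^ 2 = Q ^ (2 * (n + 1))"
  by (simp_all add: step_monom_def power_mult_distrib power_mult[symmetric] mult.commute
      del: power_Suc)

text \<open>The exponents 1, 1, 2, 2, up to \<open>n\<close>, \<open>n\<close>, doubled by squaring,
  add up to four times a triangular number.\<close>

lemma square_prod_schmidt_even:
  "square_prod (step_monom (\<lambda>i. Suc i div 2)) (2 * n) = Z ^ (2 * n) * Q ^ (4 * ((n + 1) choose 2))"
proof (induction n)
  case (Suc n)
  have *: "2 * Suc n = Suc (Suc (2 * n))" by simp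
  have "4 * ((Suc n + 1) choose 2) = 4 * ((n + 1) choose 2) + 2 * (n + 1) + 2 * (n + 1)"
    by (simp add: numeral_2_eq_2)
  moreover have "2 * Suc n = 2 * n + 2" by simp
  ultimately have "Z ^ (2 * Suc n) * Q ^ (4 * ((Suc n + 1) choose 2)) =
      Z ^ (2 * n) * Q ^ (4 * ((n + 1) choose 2)) * (Z ^ 2 * Q ^ (2 * (n + 1))) * Q ^ (2 * (n + 1))"
    by (simp only: power_add ac_simps)
  with Suc show ?case
    by (simp only: * prods_Suc step_monom_schmidt_square)
qed (simp add: binomial_eq_0)

lemma square_prod_schmidt_odd:
  "square_prod (step_monom (\<lambda>i. Suc i div 2)) (2 * n + 1) =
    Z ^ (2 * n + 2) * Q ^ (2 * (n + 1) ^ 2)"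
proof -
  \<comment> \<open>This turns \<open>4 * ((n + 1) choose 2) + 2 * (n + 1)\<close> into
    \<open>2 * (n + 1) ^ 2\<close>.\<close>
  have "2 * ((n + 1) choose 2) = n * (n + 1)"
    by (induction n) (simp_all add: numeral_2_eq_2)
  then have "2 * (n + 1) ^ 2 = 4 * ((n + 1) choose 2) + 2 * (n + 1)"
    by (simp add: power2_eq_square)
  then have "Z ^ (2 * n + 2) * Q ^ (2 * (n + 1) ^ 2) =
      Z ^ (2 * n) * Q ^ (4 * ((n + 1) choose 2)) * (Z ^ 2 * Q ^ (2 * (n + 1)))"
    by (simp only: power_add ac_simps)
  then show ?thesis
    by (simp only: Suc_eq_plus1[symmetric, of "2 * n"] prods_Suc step_monom_schmidt_square
        square_prod_schmidt_even)
qed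

lemma den_prod_schmidt_step:
  "step_monom (\<lambda>i. Suc i div 2) (Suc (2 * n)) ^ 2 = Z ^ 2 * Q ^ 2 * (Q ^ 2) ^ n"
  "step_monom (\<lambda>i. Suc i div 2) (Suc (Suc (2 * n))) ^ 2 = Q ^ 2 * (Q ^ 2) ^ n"
proof -
  have "2 * (n + 1) = 2 + 2 * n" by simp
  then show "step_monom (\<lambda>i. Suc i div 2) (Suc (2 * n)) ^ 2 = Z ^ 2 * Q ^ 2 * (Q ^ 2) ^ n"
    "step_monom (\<lambda>i. Suc i div 2) (Suc (Suc (2 * n))) ^ 2 = Q ^ 2 * (Q ^ 2) ^ n"
    unfolding step_monom_schmidt_square by (simp_all only: power_add power_mult mult.assoc)
qed

lemma den_prod_schmidt_even:
  "den_prod (step_monom (\<lambda>i. Suc i div 2)) (2 * n) =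
    qpoch (Q ^ 2) (Q ^ 2) n * qpoch (Z ^ 2 * Q ^ 2) (Q ^ 2) n"
proof (induction n)
  case (Suc n)
  have *: "2 * Suc n = Suc (Suc (2 * n))" by simp
  show ?case
    unfolding * prods_Suc qpoch_Suc den_prod_schmidt_step Suc.IH by (simp only: ac_simps)
qed (simp add: qpoch_def)

lemma den_prod_schmidt_odd:
  "den_prod (step_monom (\<lambda>i. Suc i div 2)) (2 * n + 1) =
    qpoch (Q ^ 2) (Q ^ 2) n * qpoch (Z ^ 2 * Q ^ 2) (Q ^ 2) (n + 1)"
  by (simp only: Suc_eq_plus1[symmetric] prods_Suc qpoch_Suc den_prod_schmidt_step
      den_prod_schmidt_even mult.assoc)

text \<open>The exceptional last factor equals \<open>1 - a\<close> and becomes the first factor of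
  the Pochhammer symbol, which the cross terms continue from \<open>a * q\<close> on.\<close>

lemma cross_prod_G1_even:
  assumes "\<And>m. v (Suc (2 * m)) / v (Suc (Suc (2 * m))) = - a" "\<And>m. cross_prod v m = qpoch (a * q) q m"
  shows "cross_prod_G1 v (2 * n) = qpoch a q (2 * n)"
proof (cases n)
  case (Suc m)
  then have "2 * n = Suc (Suc (2 * m))" by simp
  then show ?thesis
    by (simp add: cross_prod_G1_def assms qpoch_Suc_shift[of a q "Suc (2 * m)"])
qed (simp add: cross_prod_G1_def qpoch_def)

text \<open>The last quotient of neighbouring monomials is \<open>Z / Q\<close> for positive even
  length and \<open>1 / (Z * Q)\<close> for odd length.\<close>

lemma cross_prod_G1_weight:
  "cross_prod_G1 (step_monom (\<lambda>i. i)) (2 * n) = qpoch (- Z / Q) (Q ^ 2) (2 * n)"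
  "cross_prod_G1 (step_monom (\<lambda>i. i)) (2 * n + 1) =
    qpoch (- Z * Q) (Q ^ 2) (2 * n) * (1 + 1 / (Z * Q))"
proof -
  have "- Z / Q * Q ^ 2 = - Z * Q" by (simp add: power2_eq_square)
  then show "cross_prod_G1 (step_monom (\<lambda>i. i)) (2 * n) = qpoch (- Z / Q) (Q ^ 2) (2 * n)"
    by (intro cross_prod_G1_even) (simp add: step_monom_def, simp only: cross_prod_weight)
  show "cross_prod_G1 (step_monom (\<lambda>i. i)) (2 * n + 1) =
      qpoch (- Z * Q) (Q ^ 2) (2 * n) * (1 + 1 / (Z * Q))"
    by (simp add: cross_prod_G1_def cross_prod_weight) (simp add: step_monom_def)
qed

text \<open>At positive even length the last two exponents of \<open>Q\<close> agree, so the
  quotient is \<open>Z\<close>; at odd length it is again \<open>1 / (Z * Q)\<close>.\<close>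

lemma cross_prod_G1_schmidt:
  "cross_prod_G1 (step_monom (\<lambda>i. Suc i div 2)) (2 * n) = qpoch (- Z) Q (2 * n)"
  "cross_prod_G1 (step_monom (\<lambda>i. Suc i div 2)) (2 * n + 1) =
    qpoch (- Z * Q) Q (2 * n) * (1 + 1 / (Z * Q))"
proof -
  show "cross_prod_G1 (step_monom (\<lambda>i. Suc i div 2)) (2 * n) = qpoch (- Z) Q (2 * n)"
    by (intro cross_prod_G1_even) (simp add: step_monom_def, simp only: cross_prod_schmidt)
  show "cross_prod_G1 (step_monom (\<lambda>i. Suc i div 2)) (2 * n + 1) =
      qpoch (- Z * Q) Q (2 * n) * (1 + 1 / (Z * Q))"
    by (simp add: cross_prod_G1_def cross_prod_schmidt) (simp add: step_monom_def)
qed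

theorem theorem7p4:
  shows
    "(\<exists>s t.
        series_sums (\<lambda>n. Z ^ (2*n) * Q ^ (2 * ((2*n + 1) choose 2)) * qpoch (- Z / Q) (Q^2) (2*n)
                      / (qpoch (Q^4) (Q^4) n * qpoch (Z^2 * Q^2) (Q^4) n)) s \<and>
        series_sums (\<lambda>n. Z ^ (2*n + 2) * Q ^ (2 * ((2*n + 2) choose 2)) * qpoch (- Z * Q) (Q^2) (2*n)
                          * (1 + 1 / (Z * Q))
                      / (qpoch (Q^4) (Q^4) n * qpoch (Z^2 * Q^2) (Q^4) (n + 1))) t \<and>
        ((\<lambda>l. zq_monom (nat (alt_sum l)) (weight l)) has_sum (s + t)) G1) \<and>
     (\<exists>s t.
        series_sums (\<lambda>n. Z ^ (2*n) * Q ^ (2 * ((2*n + 1) choose 2)) * qpoch (- Z * Q) (Q^2) (2*n)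
                      / (qpoch (Q^4) (Q^4) n * qpoch (Z^2 * Q^2) (Q^4) n)) s \<and>
        series_sums (\<lambda>n. Z ^ (2*n + 2) * Q ^ (2 * ((2*n + 2) choose 2)) * qpoch (- Z * Q) (Q^2) (2*n + 1)
                      / (qpoch (Q^4) (Q^4) n * qpoch (Z^2 * Q^2) (Q^4) (n + 1))) t \<and>
        ((\<lambda>l. zq_monom (nat (alt_sum l)) (weight l)) has_sum (s + t)) G2) \<and>
     (\<exists>s t.
        series_sums (\<lambda>n. Z ^ (2*n) * Q ^ (4 * ((n + 1) choose 2)) * qpoch (- Z) Q (2*n)
                      / (qpoch (Q^2) (Q^2) n * qpoch (Z^2 * Q^2) (Q^2) n)) s \<and>
        series_sums (\<lambda>n. Z ^ (2*n + 2) * Q ^ (2 * (n + 1)^2) * qpoch (- Z * Q) Q (2*n)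
                          * (1 + 1 / (Z * Q))
                      / (qpoch (Q^2) (Q^2) n * qpoch (Z^2 * Q^2) (Q^2) (n + 1))) t \<and>
        ((\<lambda>l. zq_monom (nat (alt_sum l)) (schmidt_weight l)) has_sum (s + t)) G1) \<and>
     (\<exists>s t.
        series_sums (\<lambda>n. Z ^ (2*n) * Q ^ (4 * ((n + 1) choose 2)) * qpoch (- Z * Q) Q (2*n)
                      / (qpoch (Q^2) (Q^2) n * qpoch (Z^2 * Q^2) (Q^2) n)) s \<and>
        series_sums (\<lambda>n. Z ^ (2*n + 2) * Q ^ (2 * (n + 1)^2) * qpoch (- Z * Q) Q (2*n + 1)
                      / (qpoch (Q^2) (Q^2) n * qpoch (Z^2 * Q^2) (Q^2) (n + 1))) t \<and>
        ((\<lambda>l. zq_monom (nat (alt_sum l)) (schmidt_weight l)) has_sum (s + t)) G2)"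
proof -
  have sorted: "sorted_wrt (\<ge>) l" if "l \<in> G1" for l
    using that by (simp add: G1_def is_partition_def)
  have w: "weight l = diff_sum ((\<lambda>i. i) \<circ> Suc) l" if "l \<in> G1" for l
    using diff_sum_Suc[OF sorted[OF that]] by (simp add: o_def)
  have s: "schmidt_weight l = diff_sum ((\<lambda>i. Suc i div 2) \<circ> Suc) l" if "l \<in> G1" for l
    using diff_sum_half[OF sorted[OF that]] by (simp add: o_def)
  note weight_simps = square_prod_weight_even square_prod_weight_odd den_prod_weight_even
    den_prod_weight_odd cross_prod_weight cross_prod_G1_weight mult.assoc[symmetric]
  note schmidt_simps = square_prod_schmidt_even square_prod_schmidt_odd den_prod_schmidt_even
    den_prod_schmidt_odd cross_prod_schmidt cross_prod_G1_schmidt mult.assoc[symmetric]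
  note series =
    G1_series[of "\<lambda>i. i" _ weight, OF _ _ refl w, unfolded weight_simps]
    G2_series[of "\<lambda>i. i" _ weight, OF _ _ refl w, unfolded weight_simps]
    G1_series[of "\<lambda>i. Suc i div 2" _ schmidt_weight, OF _ _ refl s, unfolded schmidt_simps]
    G2_series[of "\<lambda>i. Suc i div 2" _ schmidt_weight, OF _ _ refl s, unfolded schmidt_simps]
  show ?thesis
    by (intro conjI; rule series) simp_all
qed

end
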